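(* Let $D_1$ and $D_2$ be two digraphs on $n_1$ and $n_2$ vertices, and $m_1$ and $m_2$ arcs, respectively. Suppose that $D_1$ is $r$-out-regular. Then (1) $$f_{L(D_1\ominus D_2)}(\lambda)=(-1)^{n_1}\left(\lambda-1-n_2-\frac{n_2}{\lambda-1}\right)^{(r-1)n_1} f_{L(D_1)}\left(r-(\lambda-r)\Bigl(\lambda-1-n_2-\frac{n_2}{\lambda-1}\Bigr)\right)\bigl[f_{L(D_2)}(\lambda-1)\bigr]^{n_1r},$$ (2) $$f_{Q(D_1\ominus D_2)}(\lambda)=\left(\lambda-1-n_2-\chi_{Q(D_2)}(\lambda-1)\right)^{(r-1)n_1} f_{Q(D_1)}\Bigl(r+(\lambda-r)\bigl(\lambda-1-n_2-\chi_{Q(D_2)}(\lambda-1)\bigr)\Bigr)\bigl[f_{Q(D_2)}(\lambda-1)\bigr]^{n_1r}.$$ In particular, the $L$-spectrum of $D_1\ominus D_2$ is completely determined by the $L$-spectra of $D_1$ and $D_2$, and the $Q$-spectrum of $D_1\ominus D_2$ is completely determined by the $Q$-spectra of $D_1$ and $D_2$, and the $Q$-coronal of $D_2$.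
   Context: Digraphs are finite, have at least one vertex, and are simple (no loops, no multiple arcs), but both arcs $uv$ and $vu$ may be present. The adjacency matrix $A(D)=[a_{ij}]$ has $a_{ij}=1$ if $v_iv_j$ is an arc and $0$ otherwise; $D_{\mathrm{out}}(D)$ is the diagonal matrix of out-degrees; $L(D)=D_{\mathrm{out}}(D)-A(D)$ is the Laplacian matrix and $Q(D)=D_{\mathrm{out}}(D)+A(D)$ the signless Laplacian matrix. $D$ is $r$-out-regular if every vertex has out-degree $r$. For an $n\times n$ real matrix $M$, $f_M(\lambda)=\det(\lambda I_n-M)$ and the coronal is $\chi_M(\lambda)=\mathbf 1_n^T(\lambda I_n-M)^{-1}\mathbf 1_n\in\mathbb C(\lambda)$, where $\mathbf 1_n$ is the all-ones column vector. The $L$-spectrum (resp. $Q$-spectrum) of $D$ is the multiset of roots of $f_{L(D)}$ (resp. $f_{Q(D)}$); the $Q$-coronal of $D$ is $\chi_{Q(D)}$. Identities are in $\mathbb C(\lambda)$. "Completely determined by" certain data means that (for $D_1$ ranging over out-regular digraphs) equal data yield equal spectra. The subdivision digraph $\mathcal S(D)$ is obtained from $D$ by replacing each arc $uv$ by a directed path $u\to w\to v$ of length two through a new vertex $w$ (one new vertex per arc); $I(D)$ denotes the set of new vertices. The subdivision-arc corona $D_1\ominus D_2$ is obtained from the disjoint union of $\mathcal S(D_1)$ and $m_1$ copies of $D_2$ ($m_1$ the number of arcs of $D_1$), one copy $D_2^{(v)}$ for each new vertex $v\in I(D_1)$, by adding, for every $v\in I(D_1)$, both arcs $vw$ and $wv$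 for all $w\in V(D_2^{(v)})$. *)

theory Defs
  imports
    "Graph_Theory.Pair_Digraph"
    "Jordan_Normal_Form.Char_Poly"
    "Jordan_Normal_Form.Gauss_Jordan_Elimination"
    "HOL-Computational_Algebra.Computational_Algebra"
    "HOL-Combinatorics.Multiset_Permutations"
begin

section \<open>Digraphs\<close>

text \<open>A digraph is a finite vertex set together with a set of ordered pairs of distinct vertices;
  opposite arcs \<open>(u, v)\<close> and \<open>(v, u)\<close> may both be present.\<close>

definition simple_digraph :: "'a pair_pre_digraph \<Rightarrow> bool" where
  "simple_digraph D \<longleftrightarrow> pair_digraph D \<and> pverts D \<noteq> {}"

definition out_regular :: "nat \<Rightarrow> 'a pair_pre_digraph \<Rightarrow> bool" where
  "out_regular r D \<longleftrightarrow> (\<forall>v\<in>pverts D. out_degree (with_proj D) v = r)"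

text \<open>The new vertex subdividing the arc \<open>e\<close> is \<open>Inr e\<close>.\<close>

definition new_verts :: "'a pair_pre_digraph \<Rightarrow> ('a + 'a \<times> 'a) set" where
  "new_verts D = Inr ` parcs D"

definition subdiv_digraph :: "'a pair_pre_digraph \<Rightarrow> ('a + 'a \<times> 'a) pair_pre_digraph" where
  "subdiv_digraph D =
     \<lparr> pverts = Inl ` pverts D \<union> new_verts D,
       parcs = {(Inl u, Inr (u, v)) | u v. (u, v) \<in> parcs D}
             \<union> {(Inr (u, v), Inl v) | u v. (u, v) \<in> parcs D} \<rparr>"

text \<open>A vertex \<open>x\<close> of the subdivision digraph becomes \<open>Inl x\<close>, and the vertex \<open>w\<close> in the
  copy of \<open>D2\<close> attached to the new vertex \<open>x\<close> becomes \<open>Inr (x, w)\<close>.\<close>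

definition arc_corona ::
  "'a pair_pre_digraph \<Rightarrow> 'b pair_pre_digraph
     \<Rightarrow> (('a + 'a \<times> 'a) + ('a + 'a \<times> 'a) \<times> 'b) pair_pre_digraph" (infixl "\<ominus>\<^sub>a" 65) where
  "D1 \<ominus>\<^sub>a D2 =
     \<lparr> pverts = Inl ` pverts (subdiv_digraph D1) \<union> Inr ` (new_verts D1 \<times> pverts D2),
       parcs = {(Inl x, Inl y) | x y. (x, y) \<in> parcs (subdiv_digraph D1)}
             \<union> {(Inr (x, a), Inr (x, b)) | x a b. x \<in> new_verts D1 \<and> (a, b) \<in> parcs D2}
             \<union> {(Inl x, Inr (x, w)) | x w. x \<in> new_verts D1 \<and> w \<in> pverts D2}
             \<union> {(Inr (x, w), Inl x) | x w. x \<in> new_verts D1 \<and> w \<in> pverts D2} \<rparr>"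

lemma simple_digraph_arc_corona:
  assumes "simple_digraph D1" "simple_digraph D2"
  shows "simple_digraph (D1 \<ominus>\<^sub>a D2)"
proof -
  interpret D1: pair_digraph D1 using assms(1) by (simp add: simple_digraph_def)
  interpret D2: pair_digraph D2 using assms(2) by (simp add: simple_digraph_def)
  have wf1: "u \<in> pverts D1 \<and> v \<in> pverts D1" if "(u, v) \<in> parcs D1" for u v
    using D1.arc_fst_in_verts[OF that] D1.arc_snd_in_verts[OF that] by simp
  have wf2: "u \<in> pverts D2 \<and> v \<in> pverts D2 \<and> u \<noteq> v" if "(u, v) \<in> parcs D2" for u v
    using D2.arc_fst_in_verts[OF that] D2.arc_snd_in_verts[OF that] D2.pair_no_loops[OF that]
    by simp
  let ?D = "D1 \<ominus>\<^sub>a D2"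
  have fin: "finite (pverts ?D)"
    using D1.pair_finite_verts D1.pair_finite_arcs D2.pair_finite_verts
    by (simp add: arc_corona_def subdiv_digraph_def new_verts_def)
  have arcs: "fst e \<in> pverts ?D \<and> snd e \<in> pverts ?D \<and> fst e \<noteq> snd e" if "e \<in> parcs ?D" for e
    using that wf1 wf2 by (auto simp: arc_corona_def subdiv_digraph_def new_verts_def)
  then have "parcs ?D \<subseteq> pverts ?D \<times> pverts ?D" by force
  then have "finite (parcs ?D)" using fin by (meson finite_SigmaI finite_subset)
  then have "pair_digraph ?D" using fin arcs by unfold_locales auto
  moreover have "pverts ?D \<noteq> {}"
    using assms(1) by (simp add: simple_digraph_def arc_corona_def subdiv_digraph_def)
  ultimately show ?thesis by (simp add: simple_digraph_def)
qed

section \<open>Matrices of a digraph\<close>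

text \<open>The matrices depend on a listing \<open>vs \<in> permutations_of_set (pverts D)\<close> of the vertices.
  Their entries are integers, taken here as complex numbers so that spectra are multisets of
  complex numbers.\<close>

definition adj_matrix :: "'a pair_pre_digraph \<Rightarrow> 'a list \<Rightarrow> complex mat" where
  "adj_matrix D vs = mat (length vs) (length vs)
     (\<lambda>(i, j). if (vs ! i, vs ! j) \<in> parcs D then 1 else 0)"

definition outdeg_matrix :: "'a pair_pre_digraph \<Rightarrow> 'a list \<Rightarrow> complex mat" where
  "outdeg_matrix D vs = mat_diag (length vs) (\<lambda>i. of_nat (out_degree (with_proj D) (vs ! i)))"

definition L_matrix :: "'a pair_pre_digraph \<Rightarrow> 'a list \<Rightarrow> complex mat" where
  "L_matrix D vs = outdeg_matrix D vs - adj_matrix D vs"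

definition Q_matrix :: "'a pair_pre_digraph \<Rightarrow> 'a list \<Rightarrow> complex mat" where
  "Q_matrix D vs = outdeg_matrix D vs + adj_matrix D vs"

definition L_spectrum :: "'a pair_pre_digraph \<Rightarrow> 'a list \<Rightarrow> complex multiset" where
  "L_spectrum D vs = proots (char_poly (L_matrix D vs))"

definition Q_spectrum :: "'a pair_pre_digraph \<Rightarrow> 'a list \<Rightarrow> complex multiset" where
  "Q_spectrum D vs = proots (char_poly (Q_matrix D vs))"

section \<open>The field of rational functions\<close>

type_synonym ratfun = "complex poly fract"

definition rf_const :: "complex \<Rightarrow> ratfun" where
  "rf_const c = to_fract [:c:]"

definition rf_var :: ratfun where
  "rf_var = to_fract [:0, 1:]"

text \<open>The characteristic polynomial of \<open>M\<close>, with the rational function \<open>\<mu>\<close> substituted for its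
  variable.\<close>

definition charpoly_at :: "complex mat \<Rightarrow> ratfun \<Rightarrow> ratfun" where
  "charpoly_at M \<mu> = poly (map_poly rf_const (char_poly M)) \<mu>"

text \<open>The coronal of \<open>M\<close> at the rational function \<open>\<mu>\<close>. The coronal itself is the value at
  \<open>\<mu> = rf_var\<close>, and for nonconstant \<open>\<mu>\<close> the value at \<open>\<mu>\<close> is the result of substituting \<open>\<mu>\<close> for
  the variable: \<open>\<mu> I - M\<close> is invertible over the rational functions, since \<open>\<mu>\<close> is not
  algebraic over the complex numbers.\<close>

definition coronal_at :: "complex mat \<Rightarrow> ratfun \<Rightarrow> ratfun" where
  "coronal_at M \<mu> =
     (let n = dim_row M; e = vec n (\<lambda>_. 1)
      in e \<bullet> (the (mat_inverse (\<mu> \<cdot>\<^sub>m 1\<^sub>m n - map_mat rf_const M)) *\<^sub>v e))"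

definition Q_coronal :: "'a pair_pre_digraph \<Rightarrow> 'a list \<Rightarrow> ratfun" where
  "Q_coronal D vs = coronal_at (Q_matrix D vs) rf_var"

end

theory Submission
  imports Defs
begin

text \<open>Both formulas are one computation of a determinant by block elimination. Let \<open>M\<close> be the
  degree matrix plus \<open>s\<close> times the adjacency matrix, with \<open>s = -1\<close> for the Laplacian and \<open>s = 1\<close> for the
  signless Laplacian. In \<open>\<lambda> I - M(D1 \<ominus>\<^sub>a D2)\<close> the copies of \<open>D2\<close> form a block diagonal matrix with
  one block \<open>(\<lambda> - 1) I - M(D2)\<close> for each of the \<open>n1 r\<close> arcs of \<open>D1\<close>. Eliminating them produces the power of
  the characteristic polynomial of \<open>D2\<close> and turns the diagonal entries of the new vertices into
  \<open>t = \<lambda> - 1 - n2 - \<chi>(\<lambda> - 1)\<close>, where \<open>\<chi>\<close> is the coronal of \<open>M(D2)\<close>. Eliminating the new vertices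
  then leaves \<open>(\<lambda> - r) I - A(D1) / t\<close> on the vertices of \<open>D1\<close>, because the product of the tail and head
  incidence matrices is \<open>A(D1)\<close>. As \<open>D1\<close> is \<open>r\<close>-out-regular, \<open>M(D1) = r I + s A(D1)\<close>, and rescaling by
  \<open>s t\<close> gives the characteristic polynomial of \<open>M(D1)\<close> at \<open>r + s (\<lambda> - r) t\<close>. The eliminations are
  instances of lemma \<open>det_on_Schur\<close>, and the outcome is lemma \<open>charpoly_at_arc_corona\<close>. For the Laplacian
  the row sums vanish, so the coronal is \<open>n2 / \<lambda>\<close> (lemma \<open>coronal_at_Laplacian\<close>).

  The computation divides by \<open>t\<close>. That \<open>t\<close> is nonzero, and that the coronal at \<open>\<lambda> - 1\<close> depends
  only on the coronal and the spectrum, both follow from the rank-one update formula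
  (lemma \<open>charpoly_at_add_all_ones\<close>): it expresses the coronal by the characteristic polynomials of
  \<open>M\<close> and of \<open>M\<close> plus the all-ones matrix, which have the same degree and admit substitution.

  For the spectra, a monic complex polynomial is determined by the multiset of its roots. Its degree
  is the number of vertices, and its second coefficient is minus the sum of the out-degrees, as there are no
  loops; so the spectrum of \<open>D1\<close> also determines \<open>n1\<close> and \<open>r\<close>, and with the other data it fixes
  every term of the formulas.\<close>

section \<open>Determinants over finite index sets\<close>

text \<open>The vertices of a corona have no natural order, and the argument below splits them into subsets and
reindexes these. A determinant indexed by a finite set makes such steps free of
bookkeeping, and shows that the listing of the vertices does not matter.\<close>

definition det_on :: "'v set \<Rightarrow> ('v \<Rightarrow> 'v \<Rightarrow> 'k) \<Rightarrow> 'k::comm_ring_1" where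
  "det_on S F = (\<Sum>p | p permutes S. of_int (sign p) * (\<Prod>i\<in>S. F i (p i)))"

definition mat_on :: "'v list \<Rightarrow> ('v \<Rightarrow> 'v \<Rightarrow> 'k) \<Rightarrow> 'k mat" where
  "mat_on vs F = mat (length vs) (length vs) (\<lambda>(i, j). F (vs ! i) (vs ! j))"

lemma mat_on_carrier [simp]: "mat_on vs F \<in> carrier_mat (length vs) (length vs)"
  by (simp add: mat_on_def)

lemma mat_on_dim [simp]: "dim_row (mat_on vs F) = length vs" "dim_col (mat_on vs F) = length vs"
  by (simp_all add: mat_on_def)

lemma mat_on_index [simp]:
  "i < length vs \<Longrightarrow> j < length vs \<Longrightarrow> mat_on vs F $$ (i, j) = F (vs ! i) (vs ! j)"
  by (simp add: mat_on_def)

lemma det_on_cong: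
  assumes "\<And>i j. i \<in> S \<Longrightarrow> j \<in> S \<Longrightarrow> F i j = G i j"
  shows "det_on S F = det_on S G"
  unfolding det_on_def using assms
  by (intro sum.cong refl arg_cong[where f = "(*) _"] prod.cong) (auto simp: permutes_in_image)

lemma det_on_image:
  assumes f: "inj_on f S" and fin: "finite S"
  shows "det_on (f ` S) F = det_on S (\<lambda>i j. F (f i) (f j))"
proof -
  let ?T = "f ` S" and ?g = "inv_into S f"
  have bij: "bij_betw f S ?T" and gij: "bij_betw ?g ?T S"
    using f by (auto simp: bij_betw_def inj_on_inv_into)
  have "det_on S (\<lambda>i j. F (f i) (f j)) = det_on ?T F"
    unfolding det_on_def
  proof (rule sum.reindex_bij_witness
      [where j = "map_permutation S f" and i = "map_permutation ?T ?g"]; clarsimp?)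
    fix p assume p: "p permutes S"
    show "map_permutation ?T ?g (map_permutation S f p) = p"
      using bij p f by (intro map_permutation_compose_inv) auto
    show "map_permutation S f p permutes ?T"
      using bij p by (rule map_permutation_permutes)
    have "(\<Prod>i\<in>?T. F i (map_permutation S f p i)) = (\<Prod>i\<in>S. F (f i) (map_permutation S f p (f i)))"
      using f by (simp add: prod.reindex)
    also have "\<dots> = (\<Prod>i\<in>S. F (f i) (f (p i)))"
      using f by (intro prod.cong) (simp_all add: map_permutation_apply)
    finally show "of_int (sign (map_permutation S f p)) * (\<Prod>i\<in>?T. F i (map_permutation S f p i))
        = of_int (sign p) * (\<Prod>i\<in>S. F (f i) (f (p i)))"
      using sign_map_permutation[OF f p fin] by simp
  next
    fix p assume p: "p permutes ?T"
    show "map_permutation S f (map_permutation ?T ?g p) = p"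
      using gij p by (intro map_permutation_compose_inv) (auto simp: f_inv_into_f)
    show "map_permutation ?T ?g p permutes S"
      using gij p by (rule map_permutation_permutes)
  qed
  then show ?thesis by simp
qed

lemma det_mat_on:
  assumes "distinct vs"
  shows "det (mat_on vs F) = det_on (set vs) F"
proof -
  have "det (mat_on vs F) = det_on {0..<length vs} (\<lambda>i j. F (vs ! i) (vs ! j))"
    unfolding det_on_def det_def'[OF mat_on_carrier]
    by (intro sum.cong refl arg_cong[where f = "(*) _"] prod.cong)
      (use permutes_in_image in fastforce)+
  also have "\<dots> = det_on ((!) vs ` {0..<length vs}) F"
    using assms by (intro det_on_image[symmetric]) (auto simp: inj_on_def nth_eq_iff_index_eq)
  also have "(!) vs ` {0..<length vs} = set vs"
    by (auto simp: set_conv_nth)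
  finally show ?thesis .
qed

text \<open>The Schur complement of the block on \<open>T\<close>, in terms of a solution \<open>X\<close> of \<open>F\<^sub>T\<^sub>T X = F\<^sub>T\<^sub>S\<close> in place of
an inverse: multiplying on the right by the unipotent matrix that subtracts the columns of \<open>T\<close>,
weighted by \<open>X\<close>, from the columns of \<open>S\<close> makes the matrix block triangular. Asking only for a
solution lets the same lemma cover block triangular matrices (\<open>X = 0\<close>), and in the
applications a solution is easier to write down than the inverse.\<close>

lemma det_on_Schur:
  fixes F :: "'v \<Rightarrow> 'v \<Rightarrow> 'k :: idom"
  assumes "finite S" "finite T" "S \<inter> T = {}"
    and X: "\<And>s t. s \<in> S \<Longrightarrow> t \<in> T \<Longrightarrow> (\<Sum>t'\<in>T. F t t' * X t' s) = F t s"
  shows "det_on (S \<union> T) F = det_on S (\<lambda>i j. F i j - (\<Sum>t\<in>T. F i t * X t j)) * det_on T F"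
proof -
  obtain xs ys where xs: "set xs = S" "distinct xs" and ys: "set ys = T" "distinct ys"
    using assms finite_distinct_list by metis
  let ?n = "length xs" and ?m = "length ys"
  define A where "A = mat_on xs F"
  define D where "D = mat_on ys F"
  define B where "B = mat ?n ?m (\<lambda>(i, j). F (xs ! i) (ys ! j))"
  define C where "C = mat ?m ?n (\<lambda>(i, j). F (ys ! i) (xs ! j))"
  define Y where "Y = mat ?m ?n (\<lambda>(i, j). - X (ys ! i) (xs ! j))"
  define A' where "A' = mat_on xs (\<lambda>i j. F i j - (\<Sum>t\<in>T. F i t * X t j))"
  define U where "U = four_block_mat (1\<^sub>m ?n) (0\<^sub>m ?n ?m) Y (1\<^sub>m ?m)"
  have carr: "A \<in> carrier_mat ?n ?n" "B \<in> carrier_mat ?n ?m" "C \<in> carrier_mat ?m ?n"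
    "D \<in> carrier_mat ?m ?m" "Y \<in> carrier_mat ?m ?n" "A' \<in> carrier_mat ?n ?n"
    by (auto simp: A_def B_def C_def D_def Y_def A'_def)
  have U: "U \<in> carrier_mat (?n + ?m) (?n + ?m)"
    by (simp add: U_def)
  have sum_ys: "(\<Sum>t\<in>T. h t) = (\<Sum>k<?m. h (ys ! k))" for h :: "'v \<Rightarrow> 'k"
    using ys sum.reindex_bij_betw[OF bij_betw_nth[of ys "{..<?m}" T], of h] by simp
  have M: "mat_on (xs @ ys) F = four_block_mat A B C D"
    by (rule eq_matI) (auto simp: A_def B_def C_def D_def nth_append)
  have AB: "A + B * Y = A'"
    by (rule eq_matI)
       (auto simp: A_def B_def Y_def A'_def scalar_prod_def sum_ys sum_negf atLeast0LessThan)
  have CD: "C + D * Y = 0\<^sub>m ?m ?n"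
  proof (rule eq_matI)
    fix i j assume "i < dim_row (0\<^sub>m ?m ?n)" "j < dim_col (0\<^sub>m ?m ?n)"
    then have ij: "i < ?m" "j < ?n" by auto
    then have "(\<Sum>t'\<in>T. F (ys ! i) t' * X t' (xs ! j)) = F (ys ! i) (xs ! j)"
      using xs ys by (intro X) auto
    then show "(C + D * Y) $$ (i, j) = 0\<^sub>m ?m ?n $$ (i, j)"
      using ij
      by (auto simp: C_def D_def Y_def scalar_prod_def sum_ys sum_negf atLeast0LessThan)
  qed (use carr in auto)
  \<comment> \<open>Column operations clear the block \<open>C\<close>.\<close>
  have "four_block_mat A B C D * U = four_block_mat A' B (0\<^sub>m ?m ?n) D"
    unfolding U_def using carr AB CD
    by (subst mult_four_block_mat[OF carr(1-4) one_carrier_mat zero_carrier_mat carr(5)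
          one_carrier_mat]) auto
  then have "det (mat_on (xs @ ys) F * U) = det A' * det D"
    unfolding M using carr by (simp add: det_four_block_mat_lower_left_zero)
  moreover have "det (mat_on (xs @ ys) F * U) = det (mat_on (xs @ ys) F) * det U"
    using mat_on_carrier[of "xs @ ys" F] U by (intro det_mult) auto
  moreover have "det U = 1"
    unfolding U_def using carr by (subst det_four_block_mat_upper_right_zero) auto
  ultimately have "det (mat_on (xs @ ys) F) = det A' * det D" by simp
  moreover have "det (mat_on (xs @ ys) F) = det_on (S \<union> T) F"
    using xs ys assms(3) by (subst det_mat_on) auto
  ultimately show ?thesis
    using xs ys by (simp add: A'_def D_def det_mat_on)
qed

lemma det_on_empty [simp]: "det_on {} F = 1"
  by (simp add: det_on_def)

lemma det_on_singleton [simp]: "det_on {a} F = F a a"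
  by (simp add: det_on_def)

lemma det_on_scale:
  assumes "finite S"
  shows "det_on S (\<lambda>i j. c * F i j) = c ^ card S * det_on S F"
  using assms by (simp add: det_on_def prod.distrib sum_distrib_left mult_ac)

lemma det_on_diagonal:
  fixes c :: "'k :: idom"
  assumes "finite S"
  shows "det_on S (\<lambda>i j. if i = j then c else 0) = c ^ card S"
  using assms
proof (induction S rule: finite_induct)
  case (insert a S)
  let ?F = "\<lambda>i j. if i = j then c else 0"
  have "det_on ({a} \<union> S) ?F = det_on {a} (\<lambda>i j. ?F i j - (\<Sum>t\<in>S. ?F i t * 0)) * det_on S ?F"
    using insert.hyps by (intro det_on_Schur) auto
  then show ?case using insert by simp
qed simp

lemma det_on_block_diagonal:
  fixes N :: "'v \<Rightarrow> 'v \<Rightarrow> 'k :: idom"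
  assumes "finite E" "finite V"
  shows "det_on (E \<times> V) (\<lambda>i j. if fst i = fst j then N (snd i) (snd j) else 0) = det_on V N ^ card E"
  using assms
proof (induction E rule: finite_induct)
  case (insert e E)
  let ?F = "\<lambda>i j. if fst i = fst j then N (snd i) (snd j) else 0"
  have split: "insert e E \<times> V = {e} \<times> V \<union> E \<times> V" by auto
  have img: "{e} \<times> V = Pair e ` V" by auto
  have "det_on ({e} \<times> V \<union> E \<times> V) ?F
      = det_on ({e} \<times> V) (\<lambda>i j. ?F i j - (\<Sum>t\<in>E \<times> V. ?F i t * 0)) * det_on (E \<times> V) ?F"
    using insert.hyps insert.prems by (intro det_on_Schur) auto
  also have "det_on ({e} \<times> V) (\<lambda>i j. ?F i j - (\<Sum>t\<in>E \<times> V. ?F i t * 0)) = det_on V N"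
    unfolding img using insert.prems by (subst det_on_image) (auto simp: inj_on_def)
  finally show ?case using insert split by simp
qed simp

section \<open>Characteristic polynomials and coronals at a rational function\<close>

lemma rf_const_hom [simp]:
  "rf_const 0 = 0" "rf_const 1 = 1" "rf_const (a + b) = rf_const a + rf_const b"
  "rf_const (a - b) = rf_const a - rf_const b" "rf_const (a * b) = rf_const a * rf_const b"
  "rf_const (- a) = - rf_const a"
proof -
  have "[:a + b:] = [:a:] + [:b:]" "[:a - b:] = [:a:] - [:b:]" "[:a * b:] = [:a:] * [:b:]"
    "[:- a:] = - [:a:]"
    by simp_all
  then show "rf_const (a + b) = rf_const a + rf_const b" "rf_const (a - b) = rf_const a - rf_const b"
    "rf_const (a * b) = rf_const a * rf_const b" "rf_const (- a) = - rf_const a"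
    unfolding rf_const_def by (simp_all only: to_fract_add to_fract_diff to_fract_mult to_fract_uminus)
qed (simp_all add: rf_const_def flip: one_pCons)

lemma rf_const_of_nat [simp]: "rf_const (of_nat k) = of_nat k"
  by (induction k) simp_all

interpretation rf_const: comm_ring_hom rf_const
  by unfold_locales simp_all

interpretation rf_const_poly: map_poly_comm_ring_hom rf_const ..

text \<open>Substitution into a polynomial is a ring homomorphism, so it commutes with the determinant that
defines the characteristic polynomial.\<close>

lemma comm_ring_hom_subst:
  "comm_ring_hom (\<lambda>p. poly (map_poly rf_const p) \<mu>)"
  by unfold_locales (simp_all add: hom_distribs)

definition pencil :: "ratfun \<Rightarrow> ('v \<Rightarrow> 'v \<Rightarrow> complex) \<Rightarrow> 'v \<Rightarrow> 'v \<Rightarrow> ratfun" where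
  "pencil \<mu> m u v = (if u = v then \<mu> else 0) - rf_const (m u v)"

lemma mat_on_pencil:
  assumes "distinct vs"
  shows "mat_on vs (pencil \<mu> m) = \<mu> \<cdot>\<^sub>m 1\<^sub>m (length vs) - map_mat rf_const (mat_on vs m)"
  using assms by (intro eq_matI) (auto simp: pencil_def nth_eq_iff_index_eq)

lemma charpoly_at_mat_on:
  assumes "distinct vs"
  shows "charpoly_at (mat_on vs m) \<mu> = det_on (set vs) (pencil \<mu> m)"
proof -
  interpret subst: comm_ring_hom "\<lambda>p. poly (map_poly rf_const p) \<mu>"
    by (rule comm_ring_hom_subst)
  have "map_mat (\<lambda>p. poly (map_poly rf_const p) \<mu>) (char_poly_matrix (mat_on vs m))
      = mat_on vs (pencil \<mu> m)"
    using assms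
    by (intro eq_matI)
      (auto simp: char_poly_matrix_def pencil_def nth_eq_iff_index_eq hom_distribs)
  then have "charpoly_at (mat_on vs m) \<mu> = det (mat_on vs (pencil \<mu> m))"
    unfolding charpoly_at_def char_poly_def by (metis subst.hom_det)
  then show ?thesis using assms by (simp add: det_mat_on)
qed

lemma charpoly_at_to_fract:
  "charpoly_at M (to_fract q) = to_fract (pcompose (char_poly M) q)"
proof -
  have "poly (map_poly rf_const p) (to_fract q) = to_fract (pcompose p q)" for p
    by (induction p) (simp_all add: hom_distribs pcompose_pCons rf_const_def)
  then show ?thesis by (simp add: charpoly_at_def)
qed

lemma char_poly_nonzero:
  assumes "M \<in> carrier_mat n n"
  shows "char_poly M \<noteq> (0 :: complex poly)"
  using degree_monic_char_poly[OF assms] by auto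

lemma charpoly_at_nonzero:
  assumes "M \<in> carrier_mat n n" "0 < degree q"
  shows "charpoly_at M (to_fract q) \<noteq> 0"
  using char_poly_nonzero[OF assms(1)] assms(2)
  by (simp add: charpoly_at_to_fract pcompose_eq_0_iff)

lemma charpoly_at_rf_var: "charpoly_at M rf_var = to_fract (char_poly M)"
  by (simp add: rf_var_def charpoly_at_to_fract pcompose_idR)

lemma sum_set_conv_nth:
  assumes "distinct vs"
  shows "(\<Sum>v\<in>set vs. h v) = (\<Sum>k<length vs. h (vs ! k))"
  using sum.reindex_bij_betw[OF bij_betw_nth[of vs "{..<length vs}" "set vs"], of h] assms by simp

lemma pencil_inverse:
  assumes "distinct vs" "charpoly_at (mat_on vs m) \<mu> \<noteq> 0"
  obtains B where "mat_inverse (mat_on vs (pencil \<mu> m)) = Some B"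
    "mat_on vs (pencil \<mu> m) * B = 1\<^sub>m (length vs)" "B * mat_on vs (pencil \<mu> m) = 1\<^sub>m (length vs)"
    "B \<in> carrier_mat (length vs) (length vs)"
proof -
  let ?N = "mat_on vs (pencil \<mu> m)"
  have "det ?N \<noteq> 0" using assms by (simp add: det_mat_on charpoly_at_mat_on)
  then have "?N \<in> Units (ring_mat TYPE(ratfun) (length vs) ())"
    by (intro det_non_zero_imp_unit) auto
  then obtain B where "mat_inverse ?N = Some B"
    using mat_inverse(1)[OF mat_on_carrier, of vs "pencil \<mu> m" "()"] by (cases "mat_inverse ?N") auto
  then show thesis
    using that mat_inverse(2)[OF mat_on_carrier] by blast
qed

text \<open>The coronal depends on the inverse only through the vector \<open>(\<mu> I - m)\<^sup>-\<^sup>1 1\<close>, the solution of one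
linear system. Lemma \<open>pencil_solution_exists\<close> provides a solution, so that the elimination
arguments below can work with it instead of the inverse matrix.\<close>

lemma coronal_at_eqI:
  assumes "distinct vs" "charpoly_at (mat_on vs m) \<mu> \<noteq> 0"
    and x: "\<And>a. a \<in> set vs \<Longrightarrow> (\<Sum>b\<in>set vs. pencil \<mu> m a b * x b) = 1"
  shows "coronal_at (mat_on vs m) \<mu> = (\<Sum>a\<in>set vs. x a)"
proof -
  let ?n = "length vs" and ?N = "mat_on vs (pencil \<mu> m)"
  obtain B where B: "mat_inverse ?N = Some B" "B * ?N = 1\<^sub>m ?n" "B \<in> carrier_mat ?n ?n"
    using pencil_inverse[OF assms(1,2)] by metis
  let ?e = "vec ?n (\<lambda>_. 1 :: ratfun)" and ?X = "vec ?n (\<lambda>i. x (vs ! i))"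
  have "?N *\<^sub>v ?X = ?e"
    using x assms(1)
    by (intro eq_vecI)
      (auto simp: scalar_prod_def sum_set_conv_nth atLeast0LessThan intro!: sum.cong)
  then have "B *\<^sub>v ?e = B *\<^sub>v (?N *\<^sub>v ?X)" by simp
  also have "\<dots> = (B * ?N) *\<^sub>v ?X"
    using B(3) by (intro assoc_mult_mat_vec[symmetric]) auto
  finally have "B *\<^sub>v ?e = ?X" using B by simp
  then have "coronal_at (mat_on vs m) \<mu> = ?e \<bullet> ?X"
    using B(1) assms(1) by (simp add: coronal_at_def mat_on_pencil Let_def)
  then show ?thesis
    using assms(1) by (simp add: scalar_prod_def sum_set_conv_nth atLeast0LessThan)
qed

lemma pencil_solution_exists:
  assumes "distinct vs" "charpoly_at (mat_on vs m) \<mu> \<noteq> 0"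
  obtains x where "\<And>a. a \<in> set vs \<Longrightarrow> (\<Sum>b\<in>set vs. pencil \<mu> m a b * x b) = 1"
proof -
  let ?n = "length vs" and ?N = "mat_on vs (pencil \<mu> m)"
  obtain B where B: "?N * B = 1\<^sub>m ?n" "B \<in> carrier_mat ?n ?n"
    using pencil_inverse[OF assms] by metis
  define e where "e = vec ?n (\<lambda>_. 1 :: ratfun)"
  define y where "y = B *\<^sub>v e"
  define x where "x v = y $ (the_inv_into {..<?n} ((!) vs) v)" for v
  have e: "e \<in> carrier_vec ?n" by (simp add: e_def)
  have y: "dim_vec y = ?n" using B by (simp add: y_def)
  have "?N *\<^sub>v y = (?N * B) *\<^sub>v e"
    unfolding y_def using B e by (intro assoc_mult_mat_vec[symmetric]) auto
  then have Ny: "?N *\<^sub>v y = e" using B e by simp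
  have inj: "inj_on ((!) vs) {..<?n}"
    using assms(1) by (auto simp: inj_on_def nth_eq_iff_index_eq)
  have x_nth: "x (vs ! k) = y $ k" if "k < ?n" for k
    using the_inv_into_f_f[OF inj, of k] that by (simp add: x_def)
  show thesis
  proof (rule that)
    fix a assume "a \<in> set vs"
    then obtain i where i: "i < ?n" "a = vs ! i" by (auto simp: in_set_conv_nth)
    have "(\<Sum>b\<in>set vs. pencil \<mu> m a b * x b) = (?N *\<^sub>v y) $ i"
      using i y assms(1)
      by (auto simp: scalar_prod_def sum_set_conv_nth atLeast0LessThan x_nth intro!: sum.cong)
    then show "(\<Sum>b\<in>set vs. pencil \<mu> m a b * x b) = 1"
      using i Ny by (simp add: e_def)
  qed
qed

text \<open>The coronal is the relative change of the characteristic polynomial when the all-ones matrix is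
added. This rank-one update formula comes from the bordered matrix with a further row and column of
ones: eliminating the block \<open>\<mu> I - m\<close> gives the right-hand side, eliminating the corner gives
the left-hand side.\<close>

lemma charpoly_at_add_all_ones:
  assumes "distinct vs" "charpoly_at (mat_on vs m) \<mu> \<noteq> 0"
  shows "charpoly_at (mat_on vs (\<lambda>u v. m u v + 1)) \<mu>
       = (1 - coronal_at (mat_on vs m) \<mu>) * charpoly_at (mat_on vs m) \<mu>"
proof -
  let ?V = "set vs"
  obtain x where x: "\<And>a. a \<in> ?V \<Longrightarrow> (\<Sum>b\<in>?V. pencil \<mu> m a b * x b) = 1"
    using pencil_solution_exists[OF assms] by blast
  define G where "G p q = (case (p, q) of (Some a, Some b) \<Rightarrow> pencil \<mu> m a b | _ \<Rightarrow> 1)"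
    for p q :: "'a option"
  have G [simp]: "G None q = 1" "G p None = 1" "G (Some a) (Some b) = pencil \<mu> m a b" for p q a b
    by (simp_all add: G_def split: option.splits)
  have sum_Some: "(\<Sum>p\<in>Some ` ?V. h p) = (\<Sum>a\<in>?V. h (Some a))" for h :: "'a option \<Rightarrow> ratfun"
    by (simp add: sum.reindex)
  have det_Some: "det_on (Some ` ?V) F = det_on ?V (\<lambda>a b. F (Some a) (Some b))"
    for F :: "'a option \<Rightarrow> 'a option \<Rightarrow> ratfun"
    by (intro det_on_image) auto
  have "det_on ({None} \<union> Some ` ?V) G
      = det_on {None} (\<lambda>p q. G p q - (\<Sum>t\<in>Some ` ?V. G p t * x (the t))) * det_on (Some ` ?V) G"
    by (rule det_on_Schur) (auto simp: sum_Some x)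
  then have 1: "det_on ({None} \<union> Some ` ?V) G = (1 - (\<Sum>a\<in>?V. x a)) * det_on ?V (pencil \<mu> m)"
    by (simp add: sum_Some det_Some)
  have "det_on (Some ` ?V \<union> {None}) G
      = det_on (Some ` ?V) (\<lambda>p q. G p q - (\<Sum>t\<in>{None}. G p t * 1)) * det_on {None} G"
    by (rule det_on_Schur) auto
  then have 2: "det_on (Some ` ?V \<union> {None}) G = det_on ?V (\<lambda>a b. pencil \<mu> m a b - 1)"
    by (simp add: det_Some)
  have "pencil \<mu> (\<lambda>u v. m u v + 1) = (\<lambda>a b. pencil \<mu> m a b - 1)"
    by (intro ext) (simp add: pencil_def)
  then show ?thesis
    using 1 2 assms(1) coronal_at_eqI[OF assms x] by (simp add: charpoly_at_mat_on Un_commute)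
qed

text \<open>By the rank-one update formula the coronal is a fixed expression in two characteristic polynomials,
so it may be transported from the variable to any nonconstant polynomial \<open>q\<close>. This is what makes the
coronal at \<open>\<lambda> - 1\<close>, which occurs in the formula for the corona, a function of the coronal and the
characteristic polynomial.\<close>

lemma coronal_at_cong:
  assumes vs: "distinct vs" "distinct vs'"
    and p: "char_poly (mat_on vs m) = char_poly (mat_on vs' m')"
    and c: "coronal_at (mat_on vs m) rf_var = coronal_at (mat_on vs' m') rf_var"
    and q: "0 < degree q"
  shows "coronal_at (mat_on vs m) (to_fract q) = coronal_at (mat_on vs' m') (to_fract q)"
proof -
  \<comment> \<open>Equal coronals at the variable make the second pair of characteristic polynomials equal.\<close>
  let ?J = "\<lambda>m u v. m u v + 1"
  note ones = charpoly_at_add_all_ones[OF _ charpoly_at_nonzero[OF mat_on_carrier]]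
  have var: "rf_var = to_fract [:0, 1:]" by (simp add: rf_var_def)
  have "charpoly_at (mat_on vs (?J m)) rf_var = charpoly_at (mat_on vs' (?J m')) rf_var"
    unfolding var using p c[unfolded var] vs
    by (simp add: ones) (simp add: charpoly_at_to_fract)
  then have "char_poly (mat_on vs (?J m)) = char_poly (mat_on vs' (?J m'))"
    by (simp add: charpoly_at_rf_var)
  then have "charpoly_at (mat_on vs (?J m)) (to_fract q) = charpoly_at (mat_on vs' (?J m')) (to_fract q)"
    by (simp add: charpoly_at_to_fract)
  moreover have "charpoly_at (mat_on vs m) (to_fract q) = charpoly_at (mat_on vs' m') (to_fract q)"
    using p by (simp add: charpoly_at_to_fract)
  ultimately show ?thesis
    using vs q charpoly_at_nonzero[OF mat_on_carrier q, of vs' m']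
    by (simp add: ones)
qed

text \<open>The coronal is a proper rational function. Were it a polynomial \<open>s\<close> of positive degree, the rank-one update
formula would equate a polynomial of degree \<open>n\<close> with one of degree \<open>n + degree s\<close>.\<close>

lemma coronal_at_not_nonconstant_polynomial:
  assumes "distinct vs" "degree q = 1" "0 < degree s"
  shows "coronal_at (mat_on vs m) (to_fract q) \<noteq> to_fract s"
proof
  assume eq: "coronal_at (mat_on vs m) (to_fract q) = to_fract s"
  let ?p = "\<lambda>m. pcompose (char_poly (mat_on vs m)) q" and ?m1 = "\<lambda>u v. m u v + 1"
  have deg: "degree (?p m) = length vs" for m
    using assms(2) degree_monic_char_poly[OF mat_on_carrier[of vs m]] by simp
  have nz: "charpoly_at (mat_on vs m) (to_fract q) \<noteq> 0"
    using assms by (intro charpoly_at_nonzero[OF mat_on_carrier]) auto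
  have "to_fract (?p ?m1) = to_fract ((1 - s) * ?p m)"
    using charpoly_at_add_all_ones[OF assms(1) nz] by (simp add: eq charpoly_at_to_fract)
  then have "?p ?m1 = (1 - s) * ?p m" by (simp only: to_fract_eq_iff)
  moreover have "degree (1 - s) = degree s"
    using assms(3) degree_add_eq_right[of 1 "- s"] by simp
  moreover have "?p m \<noteq> 0" using nz by (simp add: charpoly_at_to_fract)
  moreover have "1 - s \<noteq> 0" using assms(3) by auto
  ultimately have "degree (?p ?m1) = degree s + degree (?p m)"
    using degree_mult_eq[of "1 - s" "?p m"] by simp
  then show False using assms(3) deg by simp
qed

text \<open>A permutation other than the identity moves at least two points, so it contributes degree at most
\<open>n - 2\<close> to the determinant, and the coefficient comes from the diagonal product alone. It serves to
read off the out-degree of a regular digraph from its spectrum.\<close>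

lemma char_poly_trace:
  assumes A: "A \<in> carrier_mat n n" and n: "0 < n"
  shows "coeff (char_poly A) (n - 1) = - (\<Sum>i<n. A $$ (i, i) :: complex)"
proof -
  let ?C = "char_poly_matrix A"
  have entry: "?C $$ (i, j) = (if i = j then [:- A $$ (i, j), 1:] else [:- A $$ (i, j):])"
    if "i < n" "j < n" for i j
    using that A by (auto simp: char_poly_matrix_def)
  have off: "coeff (of_int (sign p) * (\<Prod>i = 0..<n. ?C $$ (i, p i))) (n - 1) = 0"
    if p: "p permutes {0..<n}" and "p \<noteq> id" for p
  proof -
    obtain i where i: "p i \<noteq> i" using \<open>p \<noteq> id\<close> by (auto simp: fun_eq_iff)
    then have i_mem: "i \<in> {0..<n}" using p by (metis permutes_not_in)
    then have pi_mem: "p i \<in> {0..<n}" using p by (simp only: permutes_in_image)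
    have ppi: "p (p i) \<noteq> p i" using i p by (metis permutes_inj injD)
    \<comment> \<open>The rows \<open>i\<close> and \<open>p i\<close> both contribute constants.\<close>
    have "degree (\<Prod>i = 0..<n. ?C $$ (i, p i)) \<le> (\<Sum>i = 0..<n. degree (?C $$ (i, p i)))"
      by (rule degree_prod_sum_le[unfolded o_def]) simp
    also have "\<dots> \<le> (\<Sum>k = 0..<n. if k \<in> {i, p i} then 0 else 1)"
      using i ppi p by (intro sum_mono) (auto simp: entry dest: permutes_in_image)
    also have "\<dots> = card ({0..<n} - {i, p i})"
      by (subst sum.If_cases) (simp_all add: Diff_eq Compl_eq)
    also have "\<dots> = n - 2"
      using i i_mem pi_mem by (subst card_Diff_subset) auto
    finally have "degree (of_int (sign p) * (\<Prod>i = 0..<n. ?C $$ (i, p i))) \<le> n - 2" by simp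
    moreover have "n - 2 < n - 1" using i i_mem pi_mem by auto
    ultimately show ?thesis by (intro coeff_eq_0) linarith
  qed
  have diag: "coeff (\<Prod>i\<in>S. [:- d i, 1:]) (card S) = 1
      \<and> coeff (\<Prod>i\<in>S. [:- d i, 1:]) (card S - 1) = (if S = {} then 1 else - (\<Sum>i\<in>S. d i))"
    if "finite S" for S :: "nat set" and d :: "nat \<Rightarrow> complex"
    using that
  proof (induction S rule: finite_induct)
    case (insert a S)
    let ?P = "\<Prod>i\<in>S. [:- d i, 1:]"
    have "degree ?P = card S" by (subst degree_prod_sum_eq) auto
    then have "coeff ?P (Suc (card S)) = 0" by (intro coeff_eq_0) simp
    then show ?case
      using insert by (cases "S = {}") (auto simp: coeff_pCons split: nat.splits)
  qed simp
  have "coeff (char_poly A) (n - 1)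
      = (\<Sum>p | p permutes {0..<n}. coeff (of_int (sign p) * (\<Prod>i = 0..<n. ?C $$ (i, p i))) (n - 1))"
    unfolding char_poly_def det_def'[OF char_poly_matrix_closed[OF A]] by (simp add: coeff_sum)
  also have "\<dots> = (\<Sum>p\<in>{id}. coeff (of_int (sign p) * (\<Prod>i = 0..<n. ?C $$ (i, p i))) (n - 1))"
    using off by (intro sum.mono_neutral_right) (auto simp: finite_permutations permutes_id)
  also have "\<dots> = coeff (\<Prod>i = 0..<n. [:- A $$ (i, i), 1:]) (n - 1)"
    by (simp add: entry)
  also have "\<dots> = - (\<Sum>i<n. A $$ (i, i))"
    using diag[of "{0..<n}" "\<lambda>i. A $$ (i, i)"] n
    by (auto simp: atLeast0LessThan lessThan_empty_iff)
  finally show ?thesis .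
qed

section \<open>Digraph matrices and the corona\<close>

text \<open>The sign \<open>s\<close> treats both matrices at once: \<open>s = -1\<close> is the Laplacian and \<open>s = 1\<close> the signless
Laplacian.\<close>

definition deg_adj :: "complex \<Rightarrow> 'a pair_pre_digraph \<Rightarrow> 'a \<Rightarrow> 'a \<Rightarrow> complex" where
  "deg_adj s D u v = (if u = v then of_nat (out_degree (with_proj D) u) else 0)
     + s * (if (u, v) \<in> parcs D then 1 else 0)"

lemma L_matrix_eq: "distinct vs \<Longrightarrow> L_matrix D vs = mat_on vs (deg_adj (- 1) D)"
  by (rule eq_matI)
    (auto simp: L_matrix_def outdeg_matrix_def adj_matrix_def deg_adj_def mat_diag_def
      nth_eq_iff_index_eq)

lemma Q_matrix_eq: "distinct vs \<Longrightarrow> Q_matrix D vs = mat_on vs (deg_adj 1 D)"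
  by (rule eq_matI)
    (auto simp: Q_matrix_def outdeg_matrix_def adj_matrix_def deg_adj_def mat_diag_def
      nth_eq_iff_index_eq)

lemma out_degree_eq_card: "out_degree (with_proj D) u = card {v. (u, v) \<in> parcs D}"
proof -
  have "out_arcs (with_proj D) u = Pair u ` {v. (u, v) \<in> parcs D}"
    by (auto simp: out_arcs_def)
  then show ?thesis by (simp add: out_degree_def card_image inj_on_def)
qed

lemma simple_digraphD:
  assumes "simple_digraph D"
  shows "finite (pverts D)" "finite (parcs D)" "finite {v. (u, v) \<in> parcs D}"
    "(u, v) \<in> parcs D \<Longrightarrow> u \<in> pverts D \<and> v \<in> pverts D \<and> u \<noteq> v"
proof -
  interpret pair_digraph D using assms by (simp add: simple_digraph_def)
  show "finite (pverts D)" "finite (parcs D)" by simp_all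
  have "{v. (u, v) \<in> parcs D} \<subseteq> snd ` parcs D" by force
  then show "finite {v. (u, v) \<in> parcs D}" by (rule finite_subset) simp
  assume "(u, v) \<in> parcs D"
  then show "u \<in> pverts D \<and> v \<in> pverts D \<and> u \<noteq> v"
    using arc_fst_in_verts[of "(u, v)"] arc_snd_in_verts[of "(u, v)"] pair_no_loops[of "(u, v)"]
    by auto
qed

lemma card_parcs_out_regular:
  assumes D: "simple_digraph D" and reg: "out_regular r D"
  shows "card (parcs D) = card (pverts D) * r"
proof -
  have "parcs D = Sigma (pverts D) (\<lambda>u. {v. (u, v) \<in> parcs D})"
    using simple_digraphD(4)[OF D] by auto
  then have "card (parcs D) = (\<Sum>u\<in>pverts D. card {v. (u, v) \<in> parcs D})"
    using simple_digraphD[OF D] card_SigmaI by metis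
  then show ?thesis using reg by (simp add: out_regular_def out_degree_eq_card)
qed

lemma parcs_arc_corona [simp]:
  "(Inl (Inl u), Inl (Inl v)) \<notin> parcs (D1 \<ominus>\<^sub>a D2)"
  "(Inl (Inl u), Inl (Inr e)) \<in> parcs (D1 \<ominus>\<^sub>a D2) \<longleftrightarrow> e \<in> parcs D1 \<and> fst e = u"
  "(Inl (Inr e), Inl (Inl v)) \<in> parcs (D1 \<ominus>\<^sub>a D2) \<longleftrightarrow> e \<in> parcs D1 \<and> snd e = v"
  "(Inl (Inr e), Inl (Inr e')) \<notin> parcs (D1 \<ominus>\<^sub>a D2)"
  "(Inl y, Inr (z, w)) \<in> parcs (D1 \<ominus>\<^sub>a D2) \<longleftrightarrow> y = z \<and> z \<in> new_verts D1 \<and> w \<in> pverts D2"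
  "(Inr (z, w), Inl y) \<in> parcs (D1 \<ominus>\<^sub>a D2) \<longleftrightarrow> y = z \<and> z \<in> new_verts D1 \<and> w \<in> pverts D2"
  "(Inr (y, a), Inr (z, b)) \<in> parcs (D1 \<ominus>\<^sub>a D2) \<longleftrightarrow> y = z \<and> z \<in> new_verts D1 \<and> (a, b) \<in> parcs D2"
  by (auto simp: arc_corona_def subdiv_digraph_def prod_eq_iff)

lemma out_degree_arc_corona:
  assumes D2: "simple_digraph D2"
  shows "out_degree (with_proj (D1 \<ominus>\<^sub>a D2)) (Inl (Inl u)) = out_degree (with_proj D1) u"
    and "e \<in> parcs D1 \<Longrightarrow>
      out_degree (with_proj (D1 \<ominus>\<^sub>a D2)) (Inl (Inr e)) = Suc (card (pverts D2))"
    and "z \<in> new_verts D1 \<Longrightarrow> w \<in> pverts D2 \<Longrightarrow>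
      out_degree (with_proj (D1 \<ominus>\<^sub>a D2)) (Inr (z, w)) = Suc (out_degree (with_proj D2) w)"
proof -
  let ?D = "D1 \<ominus>\<^sub>a D2"
  have "{q. (Inl (Inl u), q) \<in> parcs ?D} = (\<lambda>v. Inl (Inr (u, v))) ` {v. (u, v) \<in> parcs D1}"
    by (auto simp: arc_corona_def subdiv_digraph_def new_verts_def)
  then show "out_degree (with_proj ?D) (Inl (Inl u)) = out_degree (with_proj D1) u"
    by (simp add: out_degree_eq_card card_image inj_on_def)
next
  let ?D = "D1 \<ominus>\<^sub>a D2"
  assume "e \<in> parcs D1"
  then have "{q. (Inl (Inr e), q) \<in> parcs ?D}
      = insert (Inl (Inl (snd e))) ((\<lambda>w. Inr (Inr e, w)) ` pverts D2)"
    by (cases e) (auto simp: arc_corona_def subdiv_digraph_def new_verts_def)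
  then show "out_degree (with_proj ?D) (Inl (Inr e)) = Suc (card (pverts D2))"
    using simple_digraphD(1)[OF D2]
    by (subst out_degree_eq_card) (auto simp: card_insert_if card_image inj_on_def)
next
  let ?D = "D1 \<ominus>\<^sub>a D2"
  assume "z \<in> new_verts D1" "w \<in> pverts D2"
  then have "{q. (Inr (z, w), q) \<in> parcs ?D}
      = insert (Inl z) ((\<lambda>b. Inr (z, b)) ` {b. (w, b) \<in> parcs D2})"
    by (auto simp: arc_corona_def)
  then show "out_degree (with_proj ?D) (Inr (z, w)) = Suc (out_degree (with_proj D2) w)"
    using simple_digraphD(3)[OF D2]
    by (subst out_degree_eq_card) (auto simp: out_degree_eq_card card_insert_if card_image inj_on_def)
qed

lemma sum_image_pairs:
  assumes "finite Y" "finite W"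
  shows "(\<Sum>t\<in>Inr ` (Y \<times> W). h t) = (\<Sum>z\<in>Y. \<Sum>w\<in>W. h (Inr (z, w)))"
  by (subst sum.reindex) (auto simp: sum.cartesian_product intro!: sum.cong)

section \<open>The determinant of the corona\<close>

text \<open>The matrix of the subdivision digraph has the blocks \<open>a I\<close>, \<open>- \<sigma> R\<close>, \<open>- \<sigma> S\<close>, \<open>t I\<close>, with \<open>R\<close> the
tail incidence matrix and \<open>S\<close> the head incidence matrix. Eliminating the new vertices leaves
\<open>a I - R S / t\<close>, and \<open>R S\<close> is the adjacency matrix because an arc is determined by its ends.\<close>

lemma det_on_subdiv:
  fixes a t \<sigma> :: "'k :: field"
  assumes D: "simple_digraph D" and t: "t \<noteq> 0" and \<sigma>: "\<sigma> * \<sigma> = 1"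
  shows "det_on (pverts (subdiv_digraph D))
      (\<lambda>p q. (if p = q then (case p of Inl _ \<Rightarrow> a | Inr _ \<Rightarrow> t) else 0)
             - (if (p, q) \<in> parcs (subdiv_digraph D) then \<sigma> else 0))
    = det_on (pverts D) (\<lambda>u v. (if u = v then a else 0) - (if (u, v) \<in> parcs D then 1 / t else 0))
      * t ^ card (parcs D)"
    (is "det_on _ ?H = _")
proof -
  let ?E = "parcs D" and ?V = "pverts D"
  have fin: "finite ?V" "finite ?E" using simple_digraphD[OF D] by auto
  have arcs: "(Inl u, Inr e) \<in> parcs (subdiv_digraph D) \<longleftrightarrow> e \<in> ?E \<and> fst e = u"
    "(Inr e, Inl v) \<in> parcs (subdiv_digraph D) \<longleftrightarrow> e \<in> ?E \<and> snd e = v"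
    "(Inl u, Inl v) \<notin> parcs (subdiv_digraph D)" "(Inr e, Inr e') \<notin> parcs (subdiv_digraph D)"
    for u v e e'
    by (auto simp: subdiv_digraph_def prod_eq_iff)
  define X where "X p q = (case (p, q) of (Inr e, Inl v) \<Rightarrow> (if snd e = v then - \<sigma> / t else 0) | _ \<Rightarrow> 0)"
    for p q :: "'a + 'a \<times> 'a"
  have X [simp]: "X (Inr e) (Inl v) = (if snd e = v then - \<sigma> / t else 0)" for e v
    by (simp add: X_def)
  have sum_Inr: "(\<Sum>p\<in>Inr ` ?E. h p) = (\<Sum>e\<in>?E. h (Inr e))" for h :: "'a + 'a \<times> 'a \<Rightarrow> 'k"
    by (simp add: sum.reindex)
  have "det_on (Inl ` ?V \<union> Inr ` ?E) ?H
      = det_on (Inl ` ?V) (\<lambda>p q. ?H p q - (\<Sum>k\<in>Inr ` ?E. ?H p k * X k q)) * det_on (Inr ` ?E) ?H"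
  proof (rule det_on_Schur)
    fix p q :: "'a + 'a \<times> 'a" assume "p \<in> Inl ` ?V" "q \<in> Inr ` ?E"
    then obtain v e where v: "p = Inl v" and e: "q = Inr e" "e \<in> ?E" by auto
    have "(\<Sum>k\<in>Inr ` ?E. ?H q k * X k p)
        = (\<Sum>e'\<in>?E. if e = e' then t * (if snd e' = v then - \<sigma> / t else 0) else 0)"
      unfolding v e sum_Inr by (intro sum.cong) (auto simp: arcs)
    also have "\<dots> = ?H q p"
      using e fin t by (simp add: v arcs)
    finally show "(\<Sum>k\<in>Inr ` ?E. ?H q k * X k p) = ?H q p" .
  qed (use fin in auto)
  also have "det_on (Inr ` ?E) ?H = t ^ card ?E"
  proof -
    have "det_on (Inr ` ?E) ?H = det_on ?E (\<lambda>i j. if i = j then t else 0)"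
      using fin by (subst det_on_image) (auto simp: arcs intro!: det_on_cong)
    then show ?thesis using fin by (simp add: det_on_diagonal)
  qed
  also have "det_on (Inl ` ?V) (\<lambda>p q. ?H p q - (\<Sum>k\<in>Inr ` ?E. ?H p k * X k q))
      = det_on ?V (\<lambda>u v. (if u = v then a else 0) - (if (u, v) \<in> ?E then 1 / t else 0))"
  proof -
    have "(\<Sum>k\<in>Inr ` ?E. ?H (Inl u) k * X k (Inl v)) = (if (u, v) \<in> ?E then 1 / t else 0)" for u v
    proof -
      have "(\<Sum>k\<in>Inr ` ?E. ?H (Inl u) k * X k (Inl v))
          = (\<Sum>e\<in>?E. if e = (u, v) then 1 / t else 0)"
        unfolding sum_Inr using \<sigma> by (intro sum.cong) (auto simp: arcs)
      then show ?thesis using fin by simp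
    qed
    then show ?thesis
      using fin by (subst det_on_image) (auto simp: arcs intro!: det_on_cong)
  qed
  finally show ?thesis
    by (simp add: subdiv_digraph_def new_verts_def)
qed

text \<open>Two successive eliminations. The copies of \<open>D2\<close> form a block diagonal matrix with blocks
\<open>N = (\<mu> - 1) I - M(D2)\<close>, since every vertex of a copy has one further out-neighbour; eliminating them
splits off \<open>det N\<close> once per arc and lowers the diagonal entry \<open>\<mu> - 1 - n2\<close> of each new vertex by
\<open>1\<^sup>T N\<^sup>-\<^sup>1 1\<close>, the coronal, to \<open>t\<close>. The rest is the subdivision digraph, treated above. The two
arcs joining a new vertex to a copy vertex contribute the square of the sign, so the
coronal is subtracted for either choice of \<open>s\<close>.\<close>

lemma charpoly_at_arc_corona:
  fixes \<mu> t :: ratfun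
  assumes D1: "simple_digraph D1" and D2: "simple_digraph D2" and reg: "out_regular r D1"
    and vs1: "distinct vs1" "set vs1 = pverts D1"
    and vs2: "distinct vs2" "set vs2 = pverts D2"
    and vs: "distinct vs" "set vs = pverts (D1 \<ominus>\<^sub>a D2)"
    and s: "s * s = 1"
    and nz: "charpoly_at (mat_on vs2 (deg_adj s D2)) (\<mu> - 1) \<noteq> 0"
    and t_def: "t = \<mu> - 1 - of_nat (card (pverts D2))
                    - coronal_at (mat_on vs2 (deg_adj s D2)) (\<mu> - 1)"
    and t: "t \<noteq> 0"
  shows "charpoly_at (mat_on vs (deg_adj s (D1 \<ominus>\<^sub>a D2))) \<mu>
    = rf_const s ^ card (pverts D1) * t powi ((int r - 1) * int (card (pverts D1)))
      * charpoly_at (mat_on vs1 (deg_adj s D1)) (of_nat r + rf_const s * (\<mu> - of_nat r) * t)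
      * charpoly_at (mat_on vs2 (deg_adj s D2)) (\<mu> - 1) ^ (card (pverts D1) * r)"
proof -
  let ?D = "D1 \<ominus>\<^sub>a D2" and ?V1 = "pverts D1" and ?V2 = "pverts D2" and ?E = "new_verts D1"
  let ?S = "pverts (subdiv_digraph D1)"
  let ?N = "pencil (\<mu> - 1) (deg_adj s D2)" and ?G = "pencil \<mu> (deg_adj s (D1 \<ominus>\<^sub>a D2))"
  define \<sigma> where "\<sigma> = rf_const s"
  have \<sigma>: "\<sigma> * \<sigma> = 1" unfolding \<sigma>_def rf_const_hom(5)[symmetric] s by simp
  have \<sigma>_cancel: "\<sigma> * (\<sigma> * c) = c" for c
    using \<sigma> by (simp flip: mult.assoc)
  have fin: "finite ?V1" "finite ?V2" "finite (parcs D1)" "finite ?E" "finite ?S"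
    using simple_digraphD[OF D1] simple_digraphD[OF D2]
    by (auto simp: new_verts_def subdiv_digraph_def)
  have E_S: "?E \<subseteq> ?S" by (auto simp: subdiv_digraph_def)
  have card_E: "card ?E = card ?V1 * r"
    using card_parcs_out_regular[OF D1 reg] by (simp add: new_verts_def card_image)
  obtain x where x: "\<And>a. a \<in> ?V2 \<Longrightarrow> (\<Sum>b\<in>?V2. ?N a b * x b) = 1"
    using pencil_solution_exists[OF vs2(1) nz] unfolding vs2 by blast
  have chi: "coronal_at (mat_on vs2 (deg_adj s D2)) (\<mu> - 1) = (\<Sum>b\<in>?V2. x b)"
    using coronal_at_eqI[OF vs2(1) nz] x by (simp add: vs2)
  note deg = out_degree_arc_corona[OF D2]
  have G_copies: "?G (Inr (y, a)) (Inr (z, b)) = (if y = z then ?N a b else 0)"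
    if "y \<in> ?E" "a \<in> ?V2" for y z a b
    using that by (auto simp: pencil_def deg_adj_def deg)
  have G_down: "?G (Inr (y, a)) (Inl z) = (if y = z then - \<sigma> else 0)"
    if "y \<in> ?E" "a \<in> ?V2" for y z a
    using that by (auto simp: pencil_def deg_adj_def \<sigma>_def)
  have G_up: "?G (Inl z) (Inr (y, a)) = (if y = z then - \<sigma> else 0)"
    if "y \<in> ?E" "a \<in> ?V2" for y z a
    using that by (auto simp: pencil_def deg_adj_def \<sigma>_def)
  define X where "X p q = (case (p, q) of (Inr (z, w), Inl y) \<Rightarrow> (if z = y then - \<sigma> * x w else 0) | _ \<Rightarrow> 0)"
    for p q :: "('a + 'a \<times> 'a) + ('a + 'a \<times> 'a) \<times> 'b"
  have X [simp]: "X (Inr (z, w)) (Inl y) = (if z = y then - \<sigma> * x w else 0)" for z w y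
    by (simp add: X_def)

  \<comment> \<open>The solution \<open>X\<close> puts \<open>- \<sigma> N\<^sup>-\<^sup>1 1\<close> on the copy attached to \<open>y\<close>, in the column of \<open>y\<close>.\<close>
  have "det_on (Inl ` ?S \<union> Inr ` (?E \<times> ?V2)) ?G
      = det_on (Inl ` ?S) (\<lambda>p q. ?G p q - (\<Sum>k\<in>Inr ` (?E \<times> ?V2). ?G p k * X k q))
        * det_on (Inr ` (?E \<times> ?V2)) ?G"
  proof (rule det_on_Schur)
    fix p q :: "('a + 'a \<times> 'a) + ('a + 'a \<times> 'a) \<times> 'b"
    assume "p \<in> Inl ` ?S" "q \<in> Inr ` (?E \<times> ?V2)"
    then obtain y z a where p: "p = Inl y" and q: "q = Inr (z, a)" "z \<in> ?E" "a \<in> ?V2" by auto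
    have "(\<Sum>k\<in>Inr ` (?E \<times> ?V2). ?G q k * X k p)
        = (\<Sum>k\<in>?E. if z = k then (if z = y then - \<sigma> * (\<Sum>w\<in>?V2. ?N a w * x w) else 0) else 0)"
      unfolding sum_image_pairs[OF fin(4,2)] p q(1)
      by (intro sum.cong refl)
        (auto simp: G_copies[OF q(2,3)] sum_distrib_left mult_ac simp flip: sum_negf intro!: sum.cong)
    also have "\<dots> = ?G q p"
      using q fin by (simp add: p x G_down)
    finally show "(\<Sum>k\<in>Inr ` (?E \<times> ?V2). ?G q k * X k p) = ?G q p" .
  qed (use fin in auto)
  also have "det_on (Inr ` (?E \<times> ?V2)) ?G = det_on ?V2 ?N ^ card ?E"
  proof -
    have "det_on (Inr ` (?E \<times> ?V2)) ?G
        = det_on (?E \<times> ?V2) (\<lambda>i j. if fst i = fst j then ?N (snd i) (snd j) else 0)"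
      using fin by (subst det_on_image) (auto simp: G_copies intro!: det_on_cong)
    then show ?thesis using fin by (simp add: det_on_block_diagonal)
  qed
  also have "det_on (Inl ` ?S) (\<lambda>p q. ?G p q - (\<Sum>k\<in>Inr ` (?E \<times> ?V2). ?G p k * X k q))
      = det_on ?S (\<lambda>p q. (if p = q then (case p of Inl _ \<Rightarrow> \<mu> - of_nat r | Inr _ \<Rightarrow> t) else 0)
             - (if (p, q) \<in> parcs (subdiv_digraph D1) then \<sigma> else 0))"
  proof -
    have corr: "(\<Sum>k\<in>Inr ` (?E \<times> ?V2). ?G (Inl y) k * X k (Inl z))
        = (if y = z \<and> y \<in> ?E then (\<Sum>w\<in>?V2. x w) else 0)" for y z
    proof -
      have "(\<Sum>k\<in>Inr ` (?E \<times> ?V2). ?G (Inl y) k * X k (Inl z))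
          = (\<Sum>k\<in>?E. if k = y then (if y = z then (\<Sum>w\<in>?V2. x w) else 0) else 0)"
        unfolding sum_image_pairs[OF fin(4,2)]
        by (intro sum.cong refl) (auto simp: G_up \<sigma>_cancel intro!: sum.cong)
      then show ?thesis using fin by simp
    qed
    have main: "?G (Inl p) (Inl q) - (if p = q \<and> p \<in> ?E then (\<Sum>w\<in>?V2. x w) else 0)
        = (if p = q then (case p of Inl _ \<Rightarrow> \<mu> - of_nat r | Inr _ \<Rightarrow> t) else 0)
             - (if (p, q) \<in> parcs (subdiv_digraph D1) then \<sigma> else 0)"
      if "p \<in> ?S" "q \<in> ?S" for p q
      using that reg
      by (cases p; cases q)
        (auto simp: pencil_def deg_adj_def deg \<sigma>_def t_def chi out_regular_def
          subdiv_digraph_def new_verts_def algebra_simps)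
    show ?thesis
      using fin by (subst det_on_image) (auto simp: corr main intro!: det_on_cong)
  qed
  also have "\<dots> = det_on ?V1 (\<lambda>u v. (if u = v then \<mu> - of_nat r else 0)
      - (if (u, v) \<in> parcs D1 then 1 / t else 0)) * t ^ (card ?V1 * r)" (is "_ = det_on _ ?A * _")
    using det_on_subdiv[OF D1 t \<sigma>] card_parcs_out_regular[OF D1 reg] by simp
  finally have det: "charpoly_at (mat_on vs (deg_adj s ?D)) \<mu>
      = det_on ?V1 ?A * t ^ (card ?V1 * r) * det_on ?V2 ?N ^ (card ?V1 * r)"
    using vs by (simp add: charpoly_at_mat_on card_E arc_corona_def)

  \<comment> \<open>The argument is chosen so that its pencil for \<open>D1\<close> is \<open>\<sigma> t\<close> times the eliminated matrix.\<close>
  have "charpoly_at (mat_on vs1 (deg_adj s D1)) (of_nat r + \<sigma> * (\<mu> - of_nat r) * t)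
      = det_on ?V1 (\<lambda>u v. \<sigma> * t * ?A u v)"
    unfolding charpoly_at_mat_on[OF vs1(1)] vs1(2)
    using reg t
    by (intro det_on_cong) (auto simp: pencil_def deg_adj_def out_regular_def \<sigma>_def algebra_simps)
  also have "\<dots> = (\<sigma> * t) ^ card ?V1 * det_on ?V1 ?A"
    using fin by (simp add: det_on_scale)
  finally have D1_eq: "\<sigma> ^ card ?V1 * charpoly_at (mat_on vs1 (deg_adj s D1))
      (of_nat r + \<sigma> * (\<mu> - of_nat r) * t) = t ^ card ?V1 * det_on ?V1 ?A"
    using \<sigma> by (simp add: power_mult_distrib mult.assoc[symmetric] flip: power_mult_distrib)
  have "(int r - 1) * int (card ?V1) = int (card ?V1 * r) - int (card ?V1)"
    by (simp add: algebra_simps)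
  then have pow: "t powi ((int r - 1) * int (card ?V1)) * t ^ card ?V1 = t ^ (card ?V1 * r)"
    using t by (simp add: power_int_diff del: of_nat_mult)
  have "det_on ?V1 ?A * t ^ (card ?V1 * r)
      = t powi ((int r - 1) * int (card ?V1)) * (t ^ card ?V1 * det_on ?V1 ?A)"
    unfolding pow[symmetric] by (simp only: mult_ac)
  also have "\<dots> = \<sigma> ^ card ?V1 * t powi ((int r - 1) * int (card ?V1))
      * charpoly_at (mat_on vs1 (deg_adj s D1)) (of_nat r + \<sigma> * (\<mu> - of_nat r) * t)"
    unfolding D1_eq[symmetric] by (simp only: mult_ac)
  finally show ?thesis
    unfolding det \<sigma>_def charpoly_at_mat_on[OF vs2(1)] vs2(2) by (rule arg_cong)
qed

text \<open>Rows of the Laplacian sum to zero, so \<open>\<mu> I - L\<close> maps the constant vector \<open>1 / \<mu>\<close> to the all-ones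
vector.\<close>

lemma coronal_at_Laplacian:
  assumes D: "simple_digraph D" and vs: "distinct vs" "set vs = pverts D" and \<mu>: "\<mu> \<noteq> 0"
    and nz: "charpoly_at (mat_on vs (deg_adj (- 1) D)) \<mu> \<noteq> 0"
  shows "coronal_at (mat_on vs (deg_adj (- 1) D)) \<mu> = of_nat (card (pverts D)) / \<mu>"
proof -
  let ?V = "pverts D"
  have fin: "finite ?V" using simple_digraphD[OF D] by simp
  have "(\<Sum>b\<in>?V. pencil \<mu> (deg_adj (- 1) D) a b * (1 / \<mu>)) = 1" if a: "a \<in> ?V" for a
  proof -
    have "{v. (a, v) \<in> parcs D} = {v \<in> ?V. (a, v) \<in> parcs D}"
      using simple_digraphD(4)[OF D] by auto
    then have deg: "(\<Sum>b\<in>?V. if (a, b) \<in> parcs D then 1 else 0 :: ratfun)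
        = of_nat (out_degree (with_proj D) a)"
      using fin by (simp add: sum.If_cases out_degree_eq_card Int_def)
    have "(\<Sum>b\<in>?V. pencil \<mu> (deg_adj (- 1) D) a b)
        = (\<Sum>b\<in>?V. (if a = b then \<mu> - of_nat (out_degree (with_proj D) a) else 0)
            + (if (a, b) \<in> parcs D then 1 else 0))"
      by (intro sum.cong) (auto simp: pencil_def deg_adj_def)
    also have "\<dots> = \<mu>" using fin a deg by (simp add: sum.distrib)
    finally show ?thesis using \<mu> by (simp flip: sum_divide_distrib)
  qed
  then show ?thesis
    using coronal_at_eqI[OF vs(1) nz, of "\<lambda>_. 1 / \<mu>"] vs by simp
qed

section \<open>Spectra of the corona\<close>

lemma char_poly_eqI_proots:
  assumes "A \<in> carrier_mat n n" "B \<in> carrier_mat k k"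
    and "proots (char_poly A) = proots (char_poly (B :: complex mat))"
  shows "char_poly A = char_poly B"
proof -
  have "char_poly M = (\<Prod>x\<in>#proots (char_poly M). [:- x, 1:])" if "M \<in> carrier_mat j j" for M :: "complex mat" and j
    using complex_poly_decompose_multiset[of "char_poly M"] degree_monic_char_poly[OF that] by simp
  then show ?thesis using assms by metis
qed

lemma degree_char_poly_mat_on:
  "distinct vs \<Longrightarrow> degree (char_poly (mat_on vs m :: complex mat)) = card (set vs)"
  using degree_monic_char_poly[OF mat_on_carrier[of vs m]] by (simp add: distinct_card)

text \<open>There are no loops, so every diagonal entry is an out-degree, whatever the sign.\<close>

lemma coeff_char_poly_out_regular:
  assumes D: "simple_digraph D" "out_regular r D" and vs: "distinct vs" "set vs = pverts D"
  shows "coeff (char_poly (mat_on vs (deg_adj s D))) (card (pverts D) - 1)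
       = - of_nat (card (pverts D) * r)"
proof -
  let ?n = "card (pverts D)"
  have n: "length vs = ?n" using distinct_card[OF vs(1)] vs(2) by simp
  have "0 < ?n" using D(1) simple_digraphD(1)[OF D(1)] by (simp add: simple_digraph_def card_gt_0_iff)
  then have "coeff (char_poly (mat_on vs (deg_adj s D))) (?n - 1)
      = - (\<Sum>i<?n. mat_on vs (deg_adj s D) $$ (i, i))"
    using mat_on_carrier[of vs "deg_adj s D"] unfolding n by (intro char_poly_trace)
  also have "(\<Sum>i<?n. mat_on vs (deg_adj s D) $$ (i, i)) = (\<Sum>i<?n. of_nat r)"
  proof (rule sum.cong)
    fix i assume i: "i \<in> {..<?n}"
    then have "vs ! i \<in> pverts D" using n vs by (metis lessThan_iff nth_mem)
    moreover have "(vs ! i, vs ! i) \<notin> parcs D" using simple_digraphD(4)[OF D(1)] by blast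
    ultimately show "mat_on vs (deg_adj s D) $$ (i, i) = of_nat r"
      using D(2) i n by (simp add: deg_adj_def out_regular_def)
  qed simp
  finally show ?thesis by simp
qed

text \<open>The out-degree and the number of vertices enter the formula for the corona separately from the
spectrum of \<open>D1\<close>; equal spectra force them to agree.\<close>

lemma out_regular_eqI_char_poly:
  assumes D: "simple_digraph D" "out_regular r D" "distinct vs" "set vs = pverts D"
    and D': "simple_digraph D'" "out_regular r' D'" "distinct vs'" "set vs' = pverts D'"
    and eq: "char_poly (mat_on vs (deg_adj s D)) = char_poly (mat_on vs' (deg_adj s D'))"
  shows "card (pverts D) = card (pverts D')" "r = r'"
proof -
  show n: "card (pverts D) = card (pverts D')"
    using arg_cong[OF eq, of degree] D D' by (simp add: degree_char_poly_mat_on)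
  have "0 < card (pverts D)"
    using D(1) simple_digraphD(1)[OF D(1)] by (simp add: simple_digraph_def card_gt_0_iff)
  moreover have "(of_nat (card (pverts D) * r) :: complex) = of_nat (card (pverts D) * r')"
    using coeff_char_poly_out_regular[OF D, of s] coeff_char_poly_out_regular[OF D', of s] eq n
    by simp
  ultimately show "r = r'" by (simp only: of_nat_eq_iff) simp
qed

lemma rf_var_minus: "rf_var - 1 = to_fract [:- 1, 1:]"
proof -
  have "[:- 1, 1:] = [:0, 1:] - (1 :: complex poly)" by (simp add: one_pCons)
  then show ?thesis unfolding rf_var_def by (simp only: to_fract_diff to_fract_1)
qed

text \<open>This is the factor \<open>t\<close> by which the elimination divides and which carries a negative exponent for
\<open>r = 0\<close>. If it vanished, the coronal would be a polynomial of degree 1.\<close>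

lemma corona_factor_nonzero:
  assumes "distinct vs"
  shows "rf_var - 1 - of_nat k - coronal_at (mat_on vs m) (rf_var - 1) \<noteq> 0"
proof -
  have "rf_var - 1 - of_nat k = to_fract ([:- 1, 1:] - [:of_nat k:])"
    unfolding rf_var_minus to_fract_diff rf_const_of_nat[symmetric] rf_const_def ..
  also have "[:- 1, 1:] - [:of_nat k:] = [:- 1 - of_nat k, 1 :: complex:]" by simp
  finally show ?thesis
    using coronal_at_not_nonconstant_polynomial[OF assms, of "[:- 1, 1:]" "[:- 1 - of_nat k, 1:]" m]
    by (simp add: rf_var_minus)
qed

lemma charpoly_at_rf_var_minus_nonzero: "charpoly_at (mat_on vs m) (rf_var - 1) \<noteq> 0"
  unfolding rf_var_minus by (rule charpoly_at_nonzero[OF mat_on_carrier]) simp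

lemma char_poly_arc_corona_cong:
  assumes D1: "simple_digraph D1" "out_regular r D1" "distinct vs1" "set vs1 = pverts D1"
    and D2: "simple_digraph D2" "distinct vs2" "set vs2 = pverts D2"
    and vs: "distinct vs" "set vs = pverts (D1 \<ominus>\<^sub>a D2)"
    and D1': "simple_digraph D1'" "out_regular r' D1'" "distinct vs1'" "set vs1' = pverts D1'"
    and D2': "simple_digraph D2'" "distinct vs2'" "set vs2' = pverts D2'"
    and vs': "distinct vs'" "set vs' = pverts (D1' \<ominus>\<^sub>a D2')"
    and s: "s * s = 1"
    and eq1: "char_poly (mat_on vs1 (deg_adj s D1)) = char_poly (mat_on vs1' (deg_adj s D1'))"
    and eq2: "char_poly (mat_on vs2 (deg_adj s D2)) = char_poly (mat_on vs2' (deg_adj s D2'))"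
    and coronal: "coronal_at (mat_on vs2 (deg_adj s D2)) (rf_var - 1)
        = coronal_at (mat_on vs2' (deg_adj s D2')) (rf_var - 1)"
  shows "char_poly (mat_on vs (deg_adj s (D1 \<ominus>\<^sub>a D2)))
       = char_poly (mat_on vs' (deg_adj s (D1' \<ominus>\<^sub>a D2')))"
proof -
  note formula = charpoly_at_arc_corona[OF _ _ _ _ _ _ _ _ _ s charpoly_at_rf_var_minus_nonzero
      refl corona_factor_nonzero]
  have n2: "card (pverts D2) = card (pverts D2')"
    using arg_cong[OF eq2, of degree] D2 D2' by (simp add: degree_char_poly_mat_on)
  note n1_r = out_regular_eqI_char_poly[OF D1 D1' eq1]
  have "charpoly_at (mat_on vs (deg_adj s (D1 \<ominus>\<^sub>a D2))) rf_var
      = charpoly_at (mat_on vs' (deg_adj s (D1' \<ominus>\<^sub>a D2'))) rf_var"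
    unfolding formula[OF D1(1) D2(1) D1(2-4) D2(2,3) vs D2(2)]
      formula[OF D1'(1) D2'(1) D1'(2-4) D2'(2,3) vs' D2'(2)]
    by (simp only: n1_r n2 coronal charpoly_at_def eq1 eq2)
  then show ?thesis by (simp add: charpoly_at_rf_var)
qed

section \<open>The subdivision-arc corona\<close>

theorem theorem5p5:
  fixes D1 :: "'a pair_pre_digraph" and D2 :: "'b pair_pre_digraph"
    and n1 n2 r :: nat and lam :: ratfun
  assumes D1: "simple_digraph D1" "card (pverts D1) = n1"
    and D2: "simple_digraph D2" "card (pverts D2) = n2"
    and reg: "out_regular r D1"
    and vs1: "vs1 \<in> permutations_of_set (pverts D1)"
    and vs2: "vs2 \<in> permutations_of_set (pverts D2)"
    and vs: "vs \<in> permutations_of_set (pverts (D1 \<ominus>\<^sub>a D2))"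
    and lam_def: "lam = rf_var"
  shows
    "charpoly_at (L_matrix (D1 \<ominus>\<^sub>a D2) vs) lam =
       (- 1) ^ n1
       * (lam - 1 - of_nat n2 - of_nat n2 / (lam - 1)) powi ((int r - 1) * int n1)
       * charpoly_at (L_matrix D1 vs1)
           (of_nat r - (lam - of_nat r) * (lam - 1 - of_nat n2 - of_nat n2 / (lam - 1)))
       * charpoly_at (L_matrix D2 vs2) (lam - 1) ^ (n1 * r)
     \<and>
     charpoly_at (Q_matrix (D1 \<ominus>\<^sub>a D2) vs) lam =
       (lam - 1 - of_nat n2 - coronal_at (Q_matrix D2 vs2) (lam - 1)) powi ((int r - 1) * int n1)
       * charpoly_at (Q_matrix D1 vs1)
           (of_nat r + (lam - of_nat r)
              * (lam - 1 - of_nat n2 - coronal_at (Q_matrix D2 vs2) (lam - 1)))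
       * charpoly_at (Q_matrix D2 vs2) (lam - 1) ^ (n1 * r)
     \<and>
     (\<forall>(D1' :: 'c pair_pre_digraph) (D2' :: 'd pair_pre_digraph) r' vs1' vs2' vs'.
        simple_digraph D1' \<and> simple_digraph D2' \<and> out_regular r' D1'
        \<and> vs1' \<in> permutations_of_set (pverts D1')
        \<and> vs2' \<in> permutations_of_set (pverts D2')
        \<and> vs' \<in> permutations_of_set (pverts (D1' \<ominus>\<^sub>a D2'))
        \<longrightarrow>
          (L_spectrum D1' vs1' = L_spectrum D1 vs1 \<and> L_spectrum D2' vs2' = L_spectrum D2 vs2
             \<longrightarrow> L_spectrum (D1' \<ominus>\<^sub>a D2') vs' = L_spectrum (D1 \<ominus>\<^sub>a D2) vs)
        \<and> (Q_spectrum D1' vs1' = Q_spectrum D1 vs1 \<and> Q_spectrum D2' vs2' = Q_spectrum D2 vs2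
             \<and> Q_coronal D2' vs2' = Q_coronal D2 vs2
             \<longrightarrow> Q_spectrum (D1' \<ominus>\<^sub>a D2') vs' = Q_spectrum (D1 \<ominus>\<^sub>a D2) vs))"
proof -
  have list1: "distinct vs1" "set vs1 = pverts D1" and list2: "distinct vs2" "set vs2 = pverts D2"
    and list: "distinct vs" "set vs = pverts (D1 \<ominus>\<^sub>a D2)"
    using vs1 vs2 vs by (auto simp: permutations_of_set_def)
  have lam: "lam - 1 \<noteq> 0" by (simp add: lam_def rf_var_minus)
  note formula = charpoly_at_arc_corona[OF D1(1) D2(1) reg list1 list2 list _
      charpoly_at_rf_var_minus_nonzero refl corona_factor_nonzero[OF list2(1)], folded lam_def,
      unfolded D1(2) D2(2)]
  have flip_sign: "of_nat r + (of_nat r - lam) * c = of_nat r - (lam - of_nat r) * c" for c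
    by (simp add: algebra_simps)
  have L_coronal: "coronal_at (L_matrix D2 vs2) (lam - 1) = of_nat n2 / (lam - 1)"
    using coronal_at_Laplacian[OF D2(1) list2 lam] D2(2)
    by (simp add: L_matrix_eq list2 lam_def charpoly_at_rf_var_minus_nonzero)
  show ?thesis
  proof (intro conjI allI impI; (elim conjE)?)
    show "charpoly_at (L_matrix (D1 \<ominus>\<^sub>a D2) vs) lam =
       (- 1) ^ n1
       * (lam - 1 - of_nat n2 - of_nat n2 / (lam - 1)) powi ((int r - 1) * int n1)
       * charpoly_at (L_matrix D1 vs1)
           (of_nat r - (lam - of_nat r) * (lam - 1 - of_nat n2 - of_nat n2 / (lam - 1)))
       * charpoly_at (L_matrix D2 vs2) (lam - 1) ^ (n1 * r)"
      using formula[of "- 1"] L_coronal by (simp add: L_matrix_eq list1 list2 list flip_sign)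
    show "charpoly_at (Q_matrix (D1 \<ominus>\<^sub>a D2) vs) lam =
       (lam - 1 - of_nat n2 - coronal_at (Q_matrix D2 vs2) (lam - 1)) powi ((int r - 1) * int n1)
       * charpoly_at (Q_matrix D1 vs1)
           (of_nat r + (lam - of_nat r)
              * (lam - 1 - of_nat n2 - coronal_at (Q_matrix D2 vs2) (lam - 1)))
       * charpoly_at (Q_matrix D2 vs2) (lam - 1) ^ (n1 * r)"
      using formula[of 1] by (simp add: Q_matrix_eq list1 list2 list)
  next
    fix D1' :: "'c pair_pre_digraph" and D2' :: "'d pair_pre_digraph" and r' vs1' vs2' vs'
    assume D1': "simple_digraph D1'" and D2': "simple_digraph D2'" and reg': "out_regular r' D1'"
      and "vs1' \<in> permutations_of_set (pverts D1')" "vs2' \<in> permutations_of_set (pverts D2')"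
        "vs' \<in> permutations_of_set (pverts (D1' \<ominus>\<^sub>a D2'))"
    then have list1': "distinct vs1'" "set vs1' = pverts D1'"
      and list2': "distinct vs2'" "set vs2' = pverts D2'"
      and list': "distinct vs'" "set vs' = pverts (D1' \<ominus>\<^sub>a D2')"
      by (auto simp: permutations_of_set_def)
    note cong = char_poly_arc_corona_cong[OF D1(1) reg list1 D2(1) list2 list
        D1' reg' list1' D2' list2' list']
    note proots_cong = char_poly_eqI_proots[OF mat_on_carrier mat_on_carrier]
    {
      assume "L_spectrum D1' vs1' = L_spectrum D1 vs1" "L_spectrum D2' vs2' = L_spectrum D2 vs2"
      then have eq: "char_poly (mat_on vs1 (deg_adj (- 1) D1)) = char_poly (mat_on vs1' (deg_adj (- 1) D1'))"
        "char_poly (mat_on vs2 (deg_adj (- 1) D2)) = char_poly (mat_on vs2' (deg_adj (- 1) D2'))"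
        by (auto simp: L_spectrum_def L_matrix_eq list1 list2 list1' list2' intro!: proots_cong)
      have "card (pverts D2) = card (pverts D2')"
        using arg_cong[OF eq(2), of degree] list2 list2' by (simp add: degree_char_poly_mat_on)
      then have "coronal_at (mat_on vs2 (deg_adj (- 1) D2)) (rf_var - 1)
          = coronal_at (mat_on vs2' (deg_adj (- 1) D2')) (rf_var - 1)"
        using lam
        by (simp add: coronal_at_Laplacian[OF D2(1) list2] coronal_at_Laplacian[OF D2' list2'] lam_def
            charpoly_at_rf_var_minus_nonzero)
      then show "L_spectrum (D1' \<ominus>\<^sub>a D2') vs' = L_spectrum (D1 \<ominus>\<^sub>a D2) vs"
        using cong[of "- 1"] eq by (simp add: L_spectrum_def L_matrix_eq list list')
    next
      assume "Q_spectrum D1' vs1' = Q_spectrum D1 vs1" "Q_spectrum D2' vs2' = Q_spectrum D2 vs2"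
        and c: "Q_coronal D2' vs2' = Q_coronal D2 vs2"
      then have eq: "char_poly (mat_on vs1 (deg_adj 1 D1)) = char_poly (mat_on vs1' (deg_adj 1 D1'))"
        "char_poly (mat_on vs2 (deg_adj 1 D2)) = char_poly (mat_on vs2' (deg_adj 1 D2'))"
        by (auto simp: Q_spectrum_def Q_matrix_eq list1 list2 list1' list2' intro!: proots_cong)
      have "coronal_at (mat_on vs2 (deg_adj 1 D2)) (rf_var - 1)
          = coronal_at (mat_on vs2' (deg_adj 1 D2')) (rf_var - 1)"
        unfolding rf_var_minus using c
        by (intro coronal_at_cong list2 list2' eq)
          (simp_all add: Q_coronal_def Q_matrix_eq list2 list2')
      then show "Q_spectrum (D1' \<ominus>\<^sub>a D2') vs' = Q_spectrum (D1 \<ominus>\<^sub>a D2) vs"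
        using cong[of 1] eq by (simp add: Q_spectrum_def Q_matrix_eq list list')
    }
  qed
qed

end
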